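(* Over retention functions $R$, the functional $$\rho_D(R)=2\,\frac{-\kappa+\lambda\big(\theta\,\mathbb E R+\eta\,\mathbb E(YR)-\frac\eta2\mathbb E(R^2)\big)}{\lambda\,\mathbb E(R^2)+\beta^2}$$ is maximized by $$R_D(y)=\frac{\theta+\eta y}{\alpha^*}\wedge y,\qquad y\ge0,$$ in which the constant $\alpha^*>\eta$ uniquely solves $$\theta\,\mathbb E R+\eta\,\mathbb E(YR)-\frac{\alpha}{2}\mathbb E(R^2)=\frac{\beta^2(\alpha-\eta)+2\kappa}{2\lambda}\quad\text{with } R(y)=\frac{\theta+\eta y}{\alpha}\wedge y .$$ Moreover, the maximum value $\rho_D$ of $\rho_D(R)$ equals $\rho_D=\alpha^*-\eta>0$.
   Context: Data: $\lambda>0$, $\beta>0$, $c$, $\theta\ge0$, $\eta\ge0$ are constants. $Y$ is a positive random variable with cumulative distribution function $F_Y$ such that $F_Y(0)=0$ and $0<F_Y(y)<1$ for $y>0$; the moment generating function of $Y$ is finite in a neighborhood of $0$; $\mu=\mathbb{E}Y$ and $\sigma^2=\mathbb{E}(Y^2)$ (the second moment). It is assumed that $c>\lambda\mu$ and that $\kappa:=(1+\theta)\lambda\mu+\frac{\eta}{2}\lambda\sigma^2-c>0$. A retention function is a Borel function $R:[0,\infty)\to[0,\infty)$ with $0\le R(y)\le y$; $\mathbb E R=\mathbb E R(Y)$, $\mathbb E(YR)=\mathbb E(YR(Y))$, $\mathbb E(R^2)=\mathbb E(R(Y)^2)$. We write $a\wedge b=\min(a,b)$. *)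

theory Defs
  imports "HOL-Probability.Probability"
begin

text \<open>
  Retention functions live on \<open>[0, \<infinity>)\<close>. They are represented by Borel functions on the
  whole real line (every Borel function on \<open>[0, \<infinity>)\<close> extends to one, e.g. by \<open>0\<close>) whose
  values at negative arguments are unconstrained; those values do not affect any expectation
  below, since the claim size is almost surely positive.
\<close>

definition retention :: "(real \<Rightarrow> real) \<Rightarrow> bool" where
  "retention R \<longleftrightarrow> R \<in> borel_measurable borel \<and> (\<forall>y\<ge>0. 0 \<le> R y \<and> R y \<le> y)"

text \<open>The quadratic term is the second moment of \<open>Y\<close>, not the variance.\<close>

definition kappa ::
  "'a measure \<Rightarrow> ('a \<Rightarrow> real) \<Rightarrow> real \<Rightarrow> real \<Rightarrow> real \<Rightarrow> real \<Rightarrow> real" where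
  "kappa M Y l c \<theta> \<eta> =
     (1 + \<theta>) * l * (\<integral>\<omega>. Y \<omega> \<partial>M) + \<eta> / 2 * l * (\<integral>\<omega>. (Y \<omega>)\<^sup>2 \<partial>M) - c"

definition rho_D ::
  "'a measure \<Rightarrow> ('a \<Rightarrow> real) \<Rightarrow> real \<Rightarrow> real \<Rightarrow> real \<Rightarrow> real \<Rightarrow> real \<Rightarrow> (real \<Rightarrow> real) \<Rightarrow> real"
where
  "rho_D M Y l \<beta> c \<theta> \<eta> R =
     2 * ((- kappa M Y l c \<theta> \<eta>
            + l * (\<theta> * (\<integral>\<omega>. R (Y \<omega>) \<partial>M) + \<eta> * (\<integral>\<omega>. Y \<omega> * R (Y \<omega>) \<partial>M)
                   - \<eta> / 2 * (\<integral>\<omega>. (R (Y \<omega>))\<^sup>2 \<partial>M)))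
          / (l * (\<integral>\<omega>. (R (Y \<omega>))\<^sup>2 \<partial>M) + \<beta>\<^sup>2))"

definition R_alpha :: "real \<Rightarrow> real \<Rightarrow> real \<Rightarrow> real \<Rightarrow> real" where
  "R_alpha \<theta> \<eta> \<alpha> y = min ((\<theta> + \<eta> * y) / \<alpha>) y"

definition solves_alpha ::
  "'a measure \<Rightarrow> ('a \<Rightarrow> real) \<Rightarrow> real \<Rightarrow> real \<Rightarrow> real \<Rightarrow> real \<Rightarrow> real \<Rightarrow> real \<Rightarrow> bool"
where
  "solves_alpha M Y l \<beta> c \<theta> \<eta> \<alpha> \<longleftrightarrow>
     (let R = R_alpha \<theta> \<eta> \<alpha> in
        \<theta> * (\<integral>\<omega>. R (Y \<omega>) \<partial>M) + \<eta> * (\<integral>\<omega>. Y \<omega> * R (Y \<omega>) \<partial>M)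
          - \<alpha> / 2 * (\<integral>\<omega>. (R (Y \<omega>))\<^sup>2 \<partial>M)
        = (\<beta>\<^sup>2 * (\<alpha> - \<eta>) + 2 * kappa M Y l c \<theta> \<eta>) / (2 * l))"

end

theory Submission
  imports Defs
begin

text \<open>
  Clearing the denominator, \<open>rho_D R \<le> \<rho>\<close> says
  \<open>\<theta> E R + \<eta> E(YR) - \<alpha>/2 E(R\<^sup>2) \<le> (\<beta>\<^sup>2 \<rho> + 2\<kappa>) / (2\<lambda>)\<close> with \<open>\<alpha> = \<eta> + \<rho>\<close>. The left-hand side is
  maximized pointwise by truncating the vertex \<open>(\<theta> + \<eta> y)/\<alpha>\<close> of a parabola to \<open>[0, y]\<close>. Its maximum
  is decreasing and Lipschitz in \<open>\<alpha>\<close>, while the right-hand side increases strictly to infinity, so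
  they cross exactly once. They cross beyond \<open>\<eta>\<close> because full retention \<open>R(y) = y\<close> with
  \<open>\<alpha> = \<eta>\<close> exceeds the right-hand side by \<open>c/\<lambda> - \<mu> > 0\<close>.
\<close>

text \<open>With \<open>q = \<theta> + \<eta> * y\<close>, the gap between the two sides factors as
  \<open>(R - r) * (q - \<alpha> * (R + r) / 2)\<close>. If the vertex \<open>q / \<alpha>\<close>
  is at most \<open>y\<close>, then \<open>q = \<alpha> * R\<close> turns it into a multiple of a
  square; otherwise \<open>R = y\<close> and both factors are nonnegative.\<close>

lemma R_alpha_maximizes:
  fixes \<theta> \<eta> \<alpha> y r :: real
  assumes "\<alpha> > 0" and r: "r \<le> y"
  shows "\<theta> * r + \<eta> * (y * r) - \<alpha> / 2 * r\<^sup>2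
       \<le> \<theta> * R_alpha \<theta> \<eta> \<alpha> y + \<eta> * (y * R_alpha \<theta> \<eta> \<alpha> y) - \<alpha> / 2 * (R_alpha \<theta> \<eta> \<alpha> y)\<^sup>2"
proof -
  define R q where "R = R_alpha \<theta> \<eta> \<alpha> y" and "q = \<theta> + \<eta> * y"
  have "0 \<le> (R - r) * (q - \<alpha> * (R + r) / 2)"
  proof (cases "q / \<alpha> \<le> y")
    case True
    then have "q = \<alpha> * R"
      using assms by (simp add: R_def R_alpha_def q_def)
    then have eq: "(R - r) * (q - \<alpha> * (R + r) / 2) = \<alpha> / 2 * (R - r)\<^sup>2"
      by (simp add: algebra_simps power2_eq_square add_divide_distrib diff_divide_distrib)
    show ?thesis
      unfolding eq using assms by simp
  next
    case False
    then have R: "R = y" and q: "\<alpha> * y < q"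
      using assms by (simp_all add: R_def R_alpha_def q_def field_simps)
    have "\<alpha> * r \<le> \<alpha> * y"
      using assms by simp
    then have "0 \<le> q - \<alpha> * (R + r) / 2"
      using q by (simp add: R algebra_simps)
    then show ?thesis
      using r R by simp
  qed
  also have "\<dots> = (\<theta> * R + \<eta> * (y * R) - \<alpha> / 2 * R\<^sup>2) - (\<theta> * r + \<eta> * (y * r) - \<alpha> / 2 * r\<^sup>2)"
    by (simp add: q_def algebra_simps power2_eq_square add_divide_distrib diff_divide_distrib)
  finally show ?thesis
    by (simp add: R_def)
qed

lemma retention_R_alpha:
  assumes "\<theta> \<ge> 0" "\<eta> \<ge> 0" "\<alpha> > 0"
  shows "retention (R_alpha \<theta> \<eta> \<alpha>)"
  using assms unfolding retention_def R_alpha_def by auto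

lemma retention_id: "retention (\<lambda>y. y)"
  by (simp add: retention_def)

text \<open>The bound x^2 / 2 \<le> exp x for x \<ge> 0, taken at x = \<open>t * Y \<omega>\<close>,
  gives an integrable majorant.\<close>

lemma integrable_square_of_integrable_exp:
  fixes Y :: "'a \<Rightarrow> real"
  assumes Y: "Y \<in> borel_measurable M" "AE \<omega> in M. 0 \<le> Y \<omega>"
    and "t > 0" "integrable M (\<lambda>\<omega>. exp (t * Y \<omega>))"
  shows "integrable M (\<lambda>\<omega>. (Y \<omega>)\<^sup>2)"
proof (rule Bochner_Integration.integrable_bound)
  show "integrable M (\<lambda>\<omega>. 2 / t\<^sup>2 * exp (t * Y \<omega>))"
    using assms by simp
  show "AE \<omega> in M. norm ((Y \<omega>)\<^sup>2) \<le> norm (2 / t\<^sup>2 * exp (t * Y \<omega>))"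
    using Y(2)
  proof eventually_elim
    case (elim \<omega>)
    then have "0 \<le> t * Y \<omega>"
      using \<open>t > 0\<close> by simp
    then have "(t * Y \<omega>)\<^sup>2 / 2 \<le> exp (t * Y \<omega>)"
      using exp_lower_Taylor_quadratic[of "t * Y \<omega>"] by linarith
    then show ?case
      using \<open>t > 0\<close> by (simp add: field_simps power_mult_distrib)
  qed
qed (use Y in measurable)

locale claim = prob_space M for M :: "'a measure" +
  fixes Y :: "'a \<Rightarrow> real" and \<theta> \<eta> :: real
  assumes Y_measurable: "Y \<in> borel_measurable M"
    and Y_pos: "AE \<omega> in M. 0 < Y \<omega>"
    and Y_square: "integrable M (\<lambda>\<omega>. (Y \<omega>)\<^sup>2)"
    and \<theta>_nonneg: "0 \<le> \<theta>" and \<eta>_nonneg: "0 \<le> \<eta>"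
begin

text \<open>Parametric form of the ratio \<open>rho_D\<close>: \<open>J \<eta>\<close> carries the
  expectations in its numerator, and raising the quadratic coefficient from \<open>\<eta>\<close> to
  \<open>\<alpha>\<close> absorbs a multiple of the denominator.\<close>

definition J :: "real \<Rightarrow> (real \<Rightarrow> real) \<Rightarrow> real" where
  "J \<alpha> R = \<theta> * (\<integral>\<omega>. R (Y \<omega>) \<partial>M) + \<eta> * (\<integral>\<omega>. Y \<omega> * R (Y \<omega>) \<partial>M)
             - \<alpha> / 2 * (\<integral>\<omega>. (R (Y \<omega>))\<^sup>2 \<partial>M)"

abbreviation V :: "real \<Rightarrow> real" where
  "V \<alpha> \<equiv> J \<alpha> (R_alpha \<theta> \<eta> \<alpha>)"

section \<open>Integrability of retained claims\<close>

lemma retention_bounds: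
  assumes "retention R"
  shows "AE \<omega> in M. 0 < Y \<omega> \<and> 0 \<le> R (Y \<omega>) \<and> R (Y \<omega>) \<le> Y \<omega>"
  using Y_pos by eventually_elim (use assms in \<open>auto simp: retention_def\<close>)

lemma retention_measurable:
  assumes "retention R"
  shows "(\<lambda>\<omega>. R (Y \<omega>)) \<in> borel_measurable M"
  using assms measurable_compose[OF Y_measurable] unfolding retention_def by blast

lemma integrable_retention_square:
  assumes "retention R"
  shows "integrable M (\<lambda>\<omega>. (R (Y \<omega>))\<^sup>2)"
proof (rule Bochner_Integration.integrable_bound[OF Y_square])
  show "AE \<omega> in M. norm ((R (Y \<omega>))\<^sup>2) \<le> norm ((Y \<omega>)\<^sup>2)"
    using retention_bounds[OF assms] by eventually_elim (simp add: power_mono)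
qed (intro borel_measurable_power retention_measurable[OF assms])

lemma integrable_retention:
  assumes "retention R"
  shows "integrable M (\<lambda>\<omega>. R (Y \<omega>))"
  using retention_measurable[OF assms] integrable_retention_square[OF assms]
  by (rule square_integrable_imp_integrable)

lemma integrable_Y_retention:
  assumes "retention R"
  shows "integrable M (\<lambda>\<omega>. Y \<omega> * R (Y \<omega>))"
proof (rule Bochner_Integration.integrable_bound[OF Y_square])
  show "AE \<omega> in M. norm (Y \<omega> * R (Y \<omega>)) \<le> norm ((Y \<omega>)\<^sup>2)"
    using retention_bounds[OF assms]
    by eventually_elim (simp add: power2_eq_square mult_left_mono)
qed (intro borel_measurable_times Y_measurable retention_measurable[OF assms])

lemma retention_square_le:
  assumes "retention R"
  shows "(\<integral>\<omega>. (R (Y \<omega>))\<^sup>2 \<partial>M) \<le> (\<integral>\<omega>. (Y \<omega>)\<^sup>2 \<partial>M)"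
proof (rule integral_mono_AE[OF integrable_retention_square[OF assms] Y_square])
  show "AE \<omega> in M. (R (Y \<omega>))\<^sup>2 \<le> (Y \<omega>)\<^sup>2"
    using retention_bounds[OF assms] by eventually_elim (simp add: power_mono)
qed

lemma J_eq_integral:
  assumes "retention R"
  shows "J \<alpha> R = (\<integral>\<omega>. \<theta> * R (Y \<omega>) + \<eta> * (Y \<omega> * R (Y \<omega>)) - \<alpha> / 2 * (R (Y \<omega>))\<^sup>2 \<partial>M)"
  using integrable_retention[OF assms] integrable_Y_retention[OF assms]
    integrable_retention_square[OF assms]
  by (simp add: J_def)

text \<open>For fixed \<open>R\<close> the functional is affine in the parameter, with slope minus
  half the second moment of \<open>R (Y \<omega>)\<close>. This drives both the regularity of
  \<open>V\<close> and the reduction of \<open>rho_D\<close>.\<close>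

lemma J_diff: "J \<alpha> R = J \<alpha>' R - (\<alpha> - \<alpha>') / 2 * (\<integral>\<omega>. (R (Y \<omega>))\<^sup>2 \<partial>M)"
  by (simp add: J_def algebra_simps diff_divide_distrib)

lemma J_le_V:
  assumes "\<alpha> > 0" and R: "retention R"
  shows "J \<alpha> R \<le> V \<alpha>"
proof -
  have R': "retention (R_alpha \<theta> \<eta> \<alpha>)"
    using assms \<theta>_nonneg \<eta>_nonneg by (simp add: retention_R_alpha)
  show ?thesis
    unfolding J_eq_integral[OF R] J_eq_integral[OF R']
  proof (rule integral_mono_AE)
    show "AE \<omega> in M. \<theta> * R (Y \<omega>) + \<eta> * (Y \<omega> * R (Y \<omega>)) - \<alpha> / 2 * (R (Y \<omega>))\<^sup>2
        \<le> \<theta> * R_alpha \<theta> \<eta> \<alpha> (Y \<omega>) + \<eta> * (Y \<omega> * R_alpha \<theta> \<eta> \<alpha> (Y \<omega>))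
           - \<alpha> / 2 * (R_alpha \<theta> \<eta> \<alpha> (Y \<omega>))\<^sup>2"
      using retention_bounds[OF R]
      by eventually_elim (use assms in \<open>blast intro: R_alpha_maximizes\<close>)
  qed (intro Bochner_Integration.integrable_add Bochner_Integration.integrable_diff
      integrable_mult_right integrable_retention[OF R] integrable_retention[OF R']
      integrable_Y_retention[OF R] integrable_Y_retention[OF R']
      integrable_retention_square[OF R] integrable_retention_square[OF R'])+
qed

text \<open>The maximizer for \<open>b\<close> is a competitor for \<open>a\<close>, and there the
  smaller parameter gives the larger value.\<close>

lemma V_antimono:
  assumes "0 < a" "a \<le> b"
  shows "V b \<le> V a"
proof -
  have "V b \<le> J a (R_alpha \<theta> \<eta> b)"
    using assms by (subst J_diff[of b _ a]) simp
  also have "\<dots> \<le> V a"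
    using assms \<theta>_nonneg \<eta>_nonneg by (intro J_le_V retention_R_alpha) auto
  finally show ?thesis .
qed

text \<open>Here the maximizer for \<open>a\<close> competes for \<open>b\<close>; its loss is
  controlled because its second moment is at most that of \<open>Y\<close>. Together with
  monotonicity this makes \<open>V\<close> Lipschitz.\<close>

lemma V_lower:
  assumes "0 < a" "a \<le> b"
  shows "V a - (b - a) / 2 * (\<integral>\<omega>. (Y \<omega>)\<^sup>2 \<partial>M) \<le> V b"
proof -
  have R: "retention (R_alpha \<theta> \<eta> a)"
    using assms \<theta>_nonneg \<eta>_nonneg by (intro retention_R_alpha) auto
  have "(b - a) / 2 * (\<integral>\<omega>. (R_alpha \<theta> \<eta> a (Y \<omega>))\<^sup>2 \<partial>M) \<le> (b - a) / 2 * (\<integral>\<omega>. (Y \<omega>)\<^sup>2 \<partial>M)"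
    using assms retention_square_le[OF R] by (intro mult_left_mono) auto
  moreover have "J b (R_alpha \<theta> \<eta> a) \<le> V b"
    using assms R by (intro J_le_V) auto
  ultimately show ?thesis
    using J_diff[of b "R_alpha \<theta> \<eta> a" a] by linarith
qed

lemma V_continuous: "continuous_on {0<..} V"
proof (rule lipschitz_on_continuous_on[of "(\<integral>\<omega>. (Y \<omega>)\<^sup>2 \<partial>M) / 2"], rule lipschitz_on_leI)
  fix a b :: real
  assume ab: "a \<in> {0<..}" "b \<in> {0<..}" "a \<le> b"
  then have "dist (V a) (V b) = V a - V b"
    using V_antimono[of a b] by (simp add: dist_real_def)
  also have "\<dots> \<le> (\<integral>\<omega>. (Y \<omega>)\<^sup>2 \<partial>M) / 2 * dist a b"
    using V_lower[of a b] ab by (simp add: dist_real_def algebra_simps diff_divide_distrib)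
  finally show "dist (V a) (V b) \<le> (\<integral>\<omega>. (Y \<omega>)\<^sup>2 \<partial>M) / 2 * dist a b" .
qed simp

text \<open>Full retention serves as the competitor.\<close>

lemma V_ge: "\<alpha> > 0 \<Longrightarrow> \<theta> * (\<integral>\<omega>. Y \<omega> \<partial>M) + (\<eta> - \<alpha> / 2) * (\<integral>\<omega>. (Y \<omega>)\<^sup>2 \<partial>M) \<le> V \<alpha>"
  using J_le_V[OF _ retention_id, of \<alpha>] by (simp add: J_def algebra_simps power2_eq_square)

section \<open>Crossings of \<open>V\<close> with an increasing line\<close>

lemma V_line_crossing:
  assumes "0 < s" and "\<eta> * s + t < \<theta> * (\<integral>\<omega>. Y \<omega> \<partial>M) + \<eta> / 2 * (\<integral>\<omega>. (Y \<omega>)\<^sup>2 \<partial>M)"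
  shows "\<exists>\<alpha>>\<eta>. V \<alpha> = \<alpha> * s + t"
proof -
  define gap where "gap = \<theta> * (\<integral>\<omega>. Y \<omega> \<partial>M) + \<eta> / 2 * (\<integral>\<omega>. (Y \<omega>)\<^sup>2 \<partial>M) - (\<eta> * s + t)"
  define S where "S = (\<integral>\<omega>. (Y \<omega>)\<^sup>2 \<partial>M) / 2 + s"
  \<comment> \<open>At this point the lower bound \<open>V_ge\<close> meets the line exactly.
    Starting here rather than at \<open>\<eta>\<close> keeps the crossing strictly beyond
    \<open>\<eta>\<close> and the parameter positive even when \<open>\<eta>\<close> is 0.\<close>
  define a where "a = \<eta> + gap / S"
  have "S > 0"
    using assms(1) by (simp add: S_def add_nonneg_pos)
  have "a > \<eta>"
    using assms(2) \<open>S > 0\<close> by (simp add: a_def gap_def)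
  then have "a > 0"
    using \<eta>_nonneg by simp
  have "(a - \<eta>) * S = gap"
    using \<open>S > 0\<close> by (simp add: a_def)
  then have lower: "a * s + t \<le> V a"
    using V_ge[OF \<open>a > 0\<close>] by (simp add: gap_def S_def algebra_simps diff_divide_distrib)
  \<comment> \<open>Far enough right that the line has reached the height \<open>V a\<close>, which
    bounds \<open>V b\<close>.\<close>
  define b where "b = max a ((V a - t) / s)"
  have "a \<le> b"
    by (simp add: b_def)
  have "V a - t \<le> b * s"
    using assms(1) by (simp add: b_def pos_divide_le_eq[symmetric])
  then have upper: "V b \<le> b * s + t"
    using V_antimono[OF \<open>a > 0\<close> \<open>a \<le> b\<close>] by simp
  have "continuous_on {a..b} (\<lambda>\<alpha>. V \<alpha> - (\<alpha> * s + t))"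
    using \<open>a > 0\<close> by (intro continuous_intros continuous_on_subset[OF V_continuous]) auto
  then obtain \<alpha> where "a \<le> \<alpha>" "V \<alpha> - (\<alpha> * s + t) = 0"
    using IVT2'[of "\<lambda>\<alpha>. V \<alpha> - (\<alpha> * s + t)" b 0 a] lower upper \<open>a \<le> b\<close> by auto
  then show ?thesis
    using \<open>a > \<eta>\<close> by (intro exI[of _ \<alpha>]) auto
qed

text \<open>\<open>V\<close> never increases, while a line of positive slope strictly does.\<close>

lemma V_line_crossing_unique:
  assumes "0 < s" "0 < a" "0 < b" "V a = a * s + t" "V b = b * s + t"
  shows "a = b"
proof -
  have "\<not> x < y" if "0 < x" "V x = x * s + t" "V y = y * s + t" for x y
  proof
    assume "x < y"
    then have "x * s < y * s"
      using \<open>0 < s\<close> by simp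
    then show False
      using V_antimono[of x y] that \<open>x < y\<close> by simp
  qed
  then show ?thesis
    using assms by (meson linorder_neqE)
qed

lemma solves_alpha_iff:
  assumes "l > 0"
  shows "solves_alpha M Y l \<beta> c \<theta> \<eta> \<alpha> \<longleftrightarrow>
    V \<alpha> = \<alpha> * (\<beta>\<^sup>2 / (2 * l)) + (kappa M Y l c \<theta> \<eta> / l - \<eta> * (\<beta>\<^sup>2 / (2 * l)))"
  using assms by (simp add: solves_alpha_def Let_def J_def field_simps)

text \<open>Dinkelbach's reduction of a fractional problem: the denominator is positive, so
  comparing the ratio with \<open>\<alpha> - \<eta>\<close> amounts to comparing
  \<open>J \<alpha> R\<close> with the line.\<close>

lemma rho_D_minus:
  assumes "l > 0" "\<beta> > 0"
  shows "rho_D M Y l \<beta> c \<theta> \<eta> R - (\<alpha> - \<eta>) =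
    2 * l * (J \<alpha> R - (\<alpha> * (\<beta>\<^sup>2 / (2 * l)) + (kappa M Y l c \<theta> \<eta> / l - \<eta> * (\<beta>\<^sup>2 / (2 * l)))))
      / (l * (\<integral>\<omega>. (R (Y \<omega>))\<^sup>2 \<partial>M) + \<beta>\<^sup>2)"
proof -
  define D where "D = l * (\<integral>\<omega>. (R (Y \<omega>))\<^sup>2 \<partial>M) + \<beta>\<^sup>2"
  have "D > 0"
    using assms by (simp add: D_def add_nonneg_pos)
  define N where "N = 2 * (- kappa M Y l c \<theta> \<eta> + l * J \<eta> R)"
  have "rho_D M Y l \<beta> c \<theta> \<eta> R - (\<alpha> - \<eta>) = (N - (\<alpha> - \<eta>) * D) / D"
    using \<open>D > 0\<close> by (simp add: rho_D_def J_def N_def D_def[symmetric] diff_divide_distrib)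
  \<comment> \<open>By \<open>J_diff\<close>, the part of \<open>(\<alpha> - \<eta>) * D\<close>
    with the second moment of \<open>R (Y \<omega>)\<close> turns \<open>J \<eta>\<close> into
    \<open>J \<alpha>\<close>; the part with \<open>\<beta>\<^sup>2\<close> becomes the slope of the
    line.\<close>
  also have "N - (\<alpha> - \<eta>) * D =
    2 * l * (J \<alpha> R - (\<alpha> * (\<beta>\<^sup>2 / (2 * l)) + (kappa M Y l c \<theta> \<eta> / l - \<eta> * (\<beta>\<^sup>2 / (2 * l)))))"
    using assms by (simp add: J_diff[of \<alpha> R \<eta>] N_def D_def field_simps)
  finally show ?thesis
    by (simp add: D_def)
qed

end

theorem lemma3p1:
  fixes M :: "'a measure" and Y :: "'a \<Rightarrow> real" and l \<beta> c \<theta> \<eta> :: real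
  assumes "prob_space M"
    and "Y \<in> borel_measurable M"
    and "AE \<omega> in M. 0 < Y \<omega>"
    and "cdf (distr M borel Y) 0 = 0"
    and "\<And>y. y > 0 \<Longrightarrow> 0 < cdf (distr M borel Y) y \<and> cdf (distr M borel Y) y < 1"
    and "\<exists>\<delta>>0. \<forall>t. \<bar>t\<bar> < \<delta> \<longrightarrow> integrable M (\<lambda>\<omega>. exp (t * Y \<omega>))"
    and "l > 0" and "\<beta> > 0" and "\<theta> \<ge> 0" and "\<eta> \<ge> 0"
    and "c > l * (\<integral>\<omega>. Y \<omega> \<partial>M)"
    and "kappa M Y l c \<theta> \<eta> > 0"
  shows "\<exists>\<alpha>. \<alpha> > \<eta> \<and> solves_alpha M Y l \<beta> c \<theta> \<eta> \<alpha>
           \<and> (\<forall>a>\<eta>. solves_alpha M Y l \<beta> c \<theta> \<eta> a \<longrightarrow> a = \<alpha>)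
           \<and> is_arg_max (rho_D M Y l \<beta> c \<theta> \<eta>) retention (R_alpha \<theta> \<eta> \<alpha>)
           \<and> rho_D M Y l \<beta> c \<theta> \<eta> (R_alpha \<theta> \<eta> \<alpha>) = \<alpha> - \<eta>
           \<and> \<alpha> - \<eta> > 0"
proof -
  interpret prob_space M by fact
  obtain \<delta> where \<delta>: "\<delta> > 0" "\<And>t. \<bar>t\<bar> < \<delta> \<Longrightarrow> integrable M (\<lambda>\<omega>. exp (t * Y \<omega>))"
    using assms(6) by blast
  have "AE \<omega> in M. 0 \<le> Y \<omega>"
    using assms(3) by eventually_elim simp
  then have "integrable M (\<lambda>\<omega>. (Y \<omega>)\<^sup>2)"
    using \<delta>(1) \<delta>(2)[of "\<delta> / 2"] assms(2)
    by (intro integrable_square_of_integrable_exp[of Y M "\<delta> / 2"]) auto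
  then interpret claim M Y \<theta> \<eta>
    using assms by unfold_locales auto
  define s t where "s = \<beta>\<^sup>2 / (2 * l)" and "t = kappa M Y l c \<theta> \<eta> / l - \<eta> * s"
  have "s > 0"
    using assms by (simp add: s_def)
  have solves: "solves_alpha M Y l \<beta> c \<theta> \<eta> a \<longleftrightarrow> V a = a * s + t" for a
    using solves_alpha_iff[OF \<open>l > 0\<close>] by (simp add: s_def t_def)
  have rho: "rho_D M Y l \<beta> c \<theta> \<eta> R - (a - \<eta>)
      = 2 * l * (J a R - (a * s + t)) / (l * (\<integral>\<omega>. (R (Y \<omega>))\<^sup>2 \<partial>M) + \<beta>\<^sup>2)" for a R
    using rho_D_minus[OF \<open>l > 0\<close> \<open>\<beta> > 0\<close>] by (simp add: s_def t_def)
  \<comment> \<open>The left side is \<open>kappa\<close> divided by \<open>l\<close>, so the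
    difference of the two sides is \<open>c / l\<close> minus the mean of \<open>Y\<close>.\<close>
  have "\<eta> * s + t < \<theta> * (\<integral>\<omega>. Y \<omega> \<partial>M) + \<eta> / 2 * (\<integral>\<omega>. (Y \<omega>)\<^sup>2 \<partial>M)"
    using assms(7,11) by (simp add: t_def kappa_def field_simps)
  then obtain \<alpha> where \<alpha>: "\<alpha> > \<eta>" "V \<alpha> = \<alpha> * s + t"
    using V_line_crossing[OF \<open>s > 0\<close>] by blast
  then have "\<alpha> > 0"
    using \<open>\<eta> \<ge> 0\<close> by simp
  have unique: "a = \<alpha>" if "a > \<eta>" "solves_alpha M Y l \<beta> c \<theta> \<eta> a" for a
    using V_line_crossing_unique[OF \<open>s > 0\<close> _ \<open>\<alpha> > 0\<close> _ \<alpha>(2)] that \<open>\<eta> \<ge> 0\<close> solves by simp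
  have rho_max: "rho_D M Y l \<beta> c \<theta> \<eta> (R_alpha \<theta> \<eta> \<alpha>) = \<alpha> - \<eta>"
    using rho[of "R_alpha \<theta> \<eta> \<alpha>" \<alpha>] \<alpha>(2) by simp
  have "rho_D M Y l \<beta> c \<theta> \<eta> R \<le> \<alpha> - \<eta>" if "retention R" for R
  proof -
    \<comment> \<open>The line has height \<open>V \<alpha>\<close> at the crossing, and no
      retention function gives \<open>J \<alpha>\<close> a larger value.\<close>
    have "2 * l * (J \<alpha> R - (\<alpha> * s + t)) / (l * (\<integral>\<omega>. (R (Y \<omega>))\<^sup>2 \<partial>M) + \<beta>\<^sup>2) \<le> 0"
      using J_le_V[OF \<open>\<alpha> > 0\<close> that] \<alpha>(2) assms(7)
      by (intro divide_nonpos_nonneg mult_nonneg_nonpos) auto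
    then show ?thesis
      using rho[of R \<alpha>] by linarith
  qed
  then have "is_arg_max (rho_D M Y l \<beta> c \<theta> \<eta>) retention (R_alpha \<theta> \<eta> \<alpha>)"
    using retention_R_alpha[OF \<open>\<theta> \<ge> 0\<close> \<open>\<eta> \<ge> 0\<close> \<open>\<alpha> > 0\<close>] rho_max
    by (auto simp: is_arg_max_linorder)
  then show ?thesis
    using \<alpha>(1) rho_max solves[THEN iffD2, OF \<alpha>(2)]
    by (intro exI[of _ \<alpha>] conjI allI impI unique) simp_all
qed

end
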